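(* Let $X=\prod_{i=1}^n\{0,\dots,m_i\}$, $f\colon X\to X$, and $f^b=\beta\circ f\circ\beta^{-1}\colon\mathcal{A}\to\mathcal{A}$. Suppose that the local interaction graph $G_{f^b}(x)$ contains no cycle, for every $x\in\mathcal{A}$. Then $f^b$ has a unique fixed point.
   Context: $m_i\ge1$, $m=\sum_i m_i$; coordinates of $\{0,1\}^m$ are indexed by $I=\{(i,j)\mid 1\le i\le n,\,1\le j\le m_i\}$. $\beta\colon X\to\{0,1\}^m$ is given by $\beta_{i,j}(x)=1$ iff $x_i\ge j$; $\mathcal{A}=\beta(X)$. $e^k$ is the $k$-th unit vector, $\mathrm{sign}(0)=0$. For a map $g\colon Y\to Y$, $Y$ a set of integer vectors with coordinates indexed by a finite set $J$, the local interaction graph $G_g(z)$ at $z\in Y$ has vertex set $J$ and an edge from $j$ to $i$ with sign $s_1\,\mathrm{sign}(g_i(z+s_1e^j)-g_i(z))$ whenever $s_1\in\{-1,1\}$, $z+s_1e^j\in Y$ and this sign is nonzero. Cycles are elementary directed cycles, loops included. *)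

theory Defs
  imports Main "HOL-Library.FuncSet"
begin

text \<open>An integer vector with coordinates indexed by a set J is an extensional function
  on J, i.e. an element of \<open>J \<rightarrow>\<^sub>E UNIV\<close>, so that equality of vectors is equality of functions.\<close>

type_synonym 'j vec = "'j \<Rightarrow> int"

definition unit_vec :: "'j set \<Rightarrow> 'j \<Rightarrow> 'j vec" where
  "unit_vec J k = (\<lambda>l\<in>J. if l = k then 1 else 0)"

definition add_unit :: "'j set \<Rightarrow> 'j vec \<Rightarrow> int \<Rightarrow> 'j \<Rightarrow> 'j vec" where
  "add_unit J z s k = (\<lambda>l\<in>J. z l + s * unit_vec J k l)"

text \<open>A triple \<open>(j, s, i)\<close> is an edge from \<open>j\<close> to \<open>i\<close> with sign \<open>s\<close>; parallel edges of
  opposite signs may both be present. \<open>interaction_graph J Y g z\<close> is the edge set of the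
  local interaction graph of \<open>g : Y \<rightarrow> Y\<close> at \<open>z \<in> Y\<close>, whose vertex set is \<open>J\<close>.\<close>

type_synonym 'j edge = "'j \<times> int \<times> 'j"

definition interaction_graph ::
  "'j set \<Rightarrow> 'j vec set \<Rightarrow> ('j vec \<Rightarrow> 'j vec) \<Rightarrow> 'j vec \<Rightarrow> 'j edge set" where
  "interaction_graph J Y g z =
     {(j, s, i). j \<in> J \<and> i \<in> J \<and>
        (\<exists>s1\<in>{-1, 1}. add_unit J z s1 j \<in> Y \<and>
           s = s1 * sgn (g (add_unit J z s1 j) i - g z i) \<and> s \<noteq> 0)}"

definition edge_source :: "'j edge \<Rightarrow> 'j" where
  "edge_source e = fst e"

definition edge_target :: "'j edge \<Rightarrow> 'j" where
  "edge_target e = snd (snd e)"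

text \<open>Elementary directed cycles, as closed lists of edges visiting pairwise distinct
  vertices; a list of length one is a loop.\<close>

definition elementary_cycle :: "'j edge set \<Rightarrow> 'j edge list \<Rightarrow> bool" where
  "elementary_cycle E es \<longleftrightarrow>
     es \<noteq> [] \<and> set es \<subseteq> E \<and> distinct (map edge_source es) \<and>
     (\<forall>k<length es. edge_target (es ! k) = edge_source (es ! (Suc k mod length es)))"

definition state_space :: "nat \<Rightarrow> (nat \<Rightarrow> nat) \<Rightarrow> nat vec set" where
  "state_space n m = (\<Pi>\<^sub>E i\<in>{1..n}. {0..int (m i)})"

definition bool_index :: "nat \<Rightarrow> (nat \<Rightarrow> nat) \<Rightarrow> (nat \<times> nat) set" where
  "bool_index n m = {(i, j). 1 \<le> i \<and> i \<le> n \<and> 1 \<le> j \<and> j \<le> m i}"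

definition beta :: "nat \<Rightarrow> (nat \<Rightarrow> nat) \<Rightarrow> nat vec \<Rightarrow> (nat \<times> nat) vec" where
  "beta n m x = (\<lambda>(i, j)\<in>bool_index n m. if x i \<ge> int j then 1 else 0)"

definition admissible :: "nat \<Rightarrow> (nat \<Rightarrow> nat) \<Rightarrow> (nat \<times> nat) vec set" where
  "admissible n m = beta n m ` state_space n m"

text \<open>The inverse of \<open>beta\<close> below is genuine on the admissible vectors.\<close>

lemma inj_on_beta: "inj_on (beta n m) (state_space n m)"
proof (rule inj_onI)
  fix x y assume x: "x \<in> state_space n m" and y: "y \<in> state_space n m"
    and eq: "beta n m x = beta n m y"
  have iff: "int j \<le> x i \<longleftrightarrow> int j \<le> y i" if "i \<in> {1..n}" "1 \<le> j" "j \<le> m i" for i j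
    using fun_cong[OF eq, of "(i, j)"] that
    by (auto simp: beta_def bool_index_def split: if_splits)
  show "x = y"
  proof (rule PiE_ext[OF x[unfolded state_space_def] y[unfolded state_space_def]])
    fix i assume i: "i \<in> {1..n}"
    have bounds: "0 \<le> x i" "x i \<le> int (m i)" "0 \<le> y i" "y i \<le> int (m i)"
      using x y i by (auto simp: state_space_def PiE_iff)
    have "x i \<le> y i" using iff[OF i, of "nat (x i)"] bounds by (cases "x i = 0") auto
    moreover have "y i \<le> x i" using iff[OF i, of "nat (y i)"] bounds by (cases "y i = 0") auto
    ultimately show "x i = y i" by simp
  qed
qed

definition bool_conj ::
  "nat \<Rightarrow> (nat \<Rightarrow> nat) \<Rightarrow> (nat vec \<Rightarrow> nat vec) \<Rightarrow> (nat \<times> nat) vec \<Rightarrow> (nat \<times> nat) vec" where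
  "bool_conj n m f = beta n m \<circ> f \<circ> inv_into (state_space n m) (beta n m)"

end

theory Submission imports Defs
begin

text \<open>Acyclicity of the local graph at \<open>\<beta>(x)\<close> is used only in the following form. Given
  \<open>x \<noteq> y\<close> in \<open>X\<close>, look at the vertices \<open>(k, t\<^sub>k)\<close> with \<open>x\<^sub>k \<noteq> y\<^sub>k\<close>, where \<open>t\<^sub>k\<close> is the threshold crossed
  by a unit step from \<open>x\<^sub>k\<close> towards \<open>y\<^sub>k\<close>. One of them, say \<open>(i, t\<^sub>i)\<close>, has no edge to any of the others or
  to itself, so a unit step from \<open>x\<close> towards \<open>y\<close> in direction \<open>i\<close> leaves all the truth values of
  \<open>f\<^sub>k \<ge> t\<^sub>k\<close> unchanged. By induction on the distance, \<open>f\<close> cannot point away from \<open>y\<close> at \<open>x\<close> and away from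
  \<open>x\<close> at \<open>y\<close> in all the differing coordinates at once. The same holds if the coordinates where
  \<open>x\<close> and \<open>y\<close> are adjacent may also be exchanged by \<open>f\<close>.

  Hence the truncation of \<open>f\<close> to any box has at most one fixed point. On a box
  with sides of length at most one, the set of coordinates that the truncation moves determines the
  point; by counting, every set occurs, in particular the empty one, which gives a fixed point.
  Larger boxes follow by induction, using uniqueness on a layer.\<close>

section \<open>Cycles in graphs without sinks\<close>

lemma finite_orbit_cycle:
  assumes "finite V" "V \<noteq> {}" "\<sigma> \<in> V \<rightarrow> V"
  shows "\<exists>v\<in>V. \<exists>r>0. (\<sigma> ^^ r) v = v \<and> inj_on (\<lambda>j. (\<sigma> ^^ j) v) {..<r}"
proof -
  have closed: "(\<sigma> ^^ j) v \<in> V" if "v \<in> V" for j v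
    using that assms(3) by (induction j) auto
  have shift: "(\<sigma> ^^ (b - a)) ((\<sigma> ^^ a) v) = (\<sigma> ^^ a) v"
    if "a < b" "(\<sigma> ^^ a) v = (\<sigma> ^^ b) v" for a b :: nat and v
    using that funpow_add[of "b - a" a \<sigma>] by (simp add: fun_eq_iff)
  \<comment> \<open>Minimising over all starting points matters: a repetition within the orbit of
    \<open>v\<close> would give the other point \<open>(\<sigma> ^^ a) v\<close> a shorter
    period.\<close>
  define P where "P r \<longleftrightarrow> r > 0 \<and> (\<exists>v\<in>V. (\<sigma> ^^ r) v = v)" for r :: nat
  obtain v0 where v0: "v0 \<in> V" using assms(2) by blast
  have "range (\<lambda>j. (\<sigma> ^^ j) v0) \<subseteq> V"
    using closed[OF v0] by blast
  hence "finite (range (\<lambda>j. (\<sigma> ^^ j) v0))"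
    using assms(1) by (rule finite_subset)
  hence "\<not> inj (\<lambda>j. (\<sigma> ^^ j) v0)"
    using finite_imageD by blast
  then obtain a b :: nat where "a < b" "(\<sigma> ^^ a) v0 = (\<sigma> ^^ b) v0"
    unfolding inj_def by (metis linorder_neqE_nat)
  hence "P (b - a)"
    unfolding P_def using shift closed[OF v0] by (meson zero_less_diff)
  hence P_least: "P (Least P)"
    by (rule LeastI)
  then obtain v where v: "v \<in> V" "(\<sigma> ^^ Least P) v = v"
    unfolding P_def by blast
  have "(\<sigma> ^^ a) v \<noteq> (\<sigma> ^^ b) v" if "a < b" "b < Least P" for a b
  proof
    assume "(\<sigma> ^^ a) v = (\<sigma> ^^ b) v"
    hence "P (b - a)"
      unfolding P_def using shift closed[OF v(1)] \<open>a < b\<close> by (meson zero_less_diff)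
    thus False
      using Least_le[of P "b - a"] that by linarith
  qed
  hence "inj_on (\<lambda>j. (\<sigma> ^^ j) v) {..<Least P}"
    by (intro linorder_inj_onI) auto
  thus ?thesis
    using v P_least unfolding P_def by blast
qed

text \<open>Chosen out-edges inside \<open>V\<close> lead to a periodic orbit. Contrapositively, an
  acyclic graph has a vertex of \<open>V\<close> without edges into \<open>V\<close>.\<close>

lemma elementary_cycle_exists:
  assumes "finite V" "V \<noteq> {}"
    and out: "\<And>v. v \<in> V \<Longrightarrow> \<exists>s. \<exists>w\<in>V. (v, s, w) \<in> E"
  shows "\<exists>es. elementary_cycle E es"
proof -
  obtain s \<sigma> where \<sigma>: "\<And>v. v \<in> V \<Longrightarrow> \<sigma> v \<in> V \<and> (v, s v, \<sigma> v) \<in> E"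
    using out by metis
  hence maps: "\<sigma> \<in> V \<rightarrow> V" by blast
  obtain v r where v: "v \<in> V" and r: "r > 0" "(\<sigma> ^^ r) v = v"
    and inj: "inj_on (\<lambda>j. (\<sigma> ^^ j) v) {..<r}"
    using finite_orbit_cycle[OF assms(1,2) maps] by blast
  have closed: "(\<sigma> ^^ j) v \<in> V" for j
    using v maps by (induction j) auto
  define es where
    "es = map (\<lambda>j. ((\<sigma> ^^ j) v, s ((\<sigma> ^^ j) v), \<sigma> ((\<sigma> ^^ j) v))) [0..<r]"
  have "es \<noteq> []" and "set es \<subseteq> E"
    using r \<sigma> closed by (auto simp: es_def)
  moreover have "distinct (map edge_source es)"
    using inj by (simp add: es_def edge_source_def distinct_map comp_def lessThan_atLeast0)
  moreover have "edge_target (es ! k) = edge_source (es ! (Suc k mod length es))"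
    if "k < length es" for k
  proof (cases "Suc k = r")
    case True
    hence "\<sigma> ((\<sigma> ^^ k) v) = v"
      using r(2) by auto
    thus ?thesis
      using True r(1) by (simp add: es_def edge_source_def edge_target_def)
  next
    case False
    thus ?thesis
      using that by (simp add: es_def edge_source_def edge_target_def)
  qed
  ultimately show ?thesis
    unfolding elementary_cycle_def by blast
qed

section \<open>Fixed points of truncated maps\<close>

definition box :: "'a set \<Rightarrow> 'a vec \<Rightarrow> 'a vec \<Rightarrow> 'a vec set" where
  "box I p q = (\<Pi>\<^sub>E i\<in>I. {p i..q i})"

definition step_toward :: "'a vec \<Rightarrow> 'a vec \<Rightarrow> 'a \<Rightarrow> 'a vec" where
  "step_toward x y i = x(i := x i + sgn (y i - x i))"

text \<open>For \<open>a \<noteq> b\<close> this is the larger of \<open>a\<close> and its neighbour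
  towards \<open>b\<close>, hence the bit of the unary code that the step flips.\<close>

definition threshold :: "int \<Rightarrow> int \<Rightarrow> int" where
  "threshold a b = (if a < b then a + 1 else a)"

text \<open>Here \<open>u\<close> and \<open>w\<close> are the images of \<open>a\<close> and
  \<open>b\<close>. The first two alternatives include the case that both are fixed; the last two
  are exchanges of adjacent values, possibly overshooting.\<close>

definition opposed :: "int \<Rightarrow> int \<Rightarrow> int \<Rightarrow> int \<Rightarrow> bool" where
  "opposed a b u w \<longleftrightarrow>
     (a < b \<and> u \<le> a \<and> b \<le> w) \<or> (b < a \<and> a \<le> u \<and> w \<le> b) \<or>
     (b = a + 1 \<and> b \<le> u \<and> w \<le> a) \<or> (a = b + 1 \<and> u \<le> b \<and> a \<le> w)"

definition clamped_fixpoint ::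
  "'a set \<Rightarrow> ('a vec \<Rightarrow> 'a vec) \<Rightarrow> 'a vec \<Rightarrow> 'a vec \<Rightarrow> 'a vec \<Rightarrow> bool" where
  "clamped_fixpoint I f p q x \<longleftrightarrow>
     x \<in> box I p q \<and> (\<forall>k\<in>I. max (p k) (min (q k) (f x k)) = x k)"

text \<open>For adjacent \<open>a\<close> and \<open>b\<close> every alternative of
  \<open>opposed\<close> puts \<open>u\<close> and \<open>w\<close> on different sides of the
  threshold.\<close>

lemma not_opposed_adjacent:
  assumes "a + sgn (b - a) = b" "a \<noteq> b" "w \<ge> threshold a b \<longleftrightarrow> u \<ge> threshold a b"
  shows "\<not> opposed a b u w"
proof (cases "a < b")
  case True
  hence "b = a + 1" using assms(1) by simp
  thus ?thesis using assms(3) unfolding opposed_def threshold_def by auto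
next
  case False
  hence "a = b + 1" using assms(1,2) by simp
  thus ?thesis using assms(3) unfolding opposed_def threshold_def by auto
qed

text \<open>If \<open>a' = a\<close>, \<open>opposed\<close> sees \<open>u\<close> only through the
  threshold test. Otherwise \<open>a\<close> and \<open>b\<close> are at distance at least two,
  which rules out the exchange alternatives.\<close>

lemma opposed_step:
  assumes "opposed a b u w" "a' = a \<or> a' = a + sgn (b - a)" "a' \<noteq> b"
    and "u' \<ge> threshold a b \<longleftrightarrow> u \<ge> threshold a b"
  shows "opposed a' b u' w"
proof (cases "a' = a")
  case True
  thus ?thesis
    using assms(1,4) unfolding opposed_def threshold_def by auto
next
  case False
  hence a': "a' = a + sgn (b - a)" using assms(2) by blast
  consider "a < b" | "b < a" using False a' by fastforce
  thus ?thesis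
  proof cases
    case 1
    hence "a + 1 < b" "a' = a + 1" using a' assms(3) by simp_all
    thus ?thesis using assms(1,4) unfolding opposed_def threshold_def by auto
  next
    case 2
    hence "b + 1 < a" "a' = a - 1" using a' assms(3) by simp_all
    thus ?thesis using assms(1,4) unfolding opposed_def threshold_def by auto
  qed
qed

text \<open>Distinct \<open>a\<close> and \<open>b\<close> are the two ends of the interval, and
  truncation either fixes both or exchanges them.\<close>

lemma opposed_unit_interval:
  fixes a b c d u w :: int
  assumes "c \<le> a" "a \<le> d" "c \<le> b" "b \<le> d" "d \<le> c + 1" "a \<noteq> b"
    and "max c (min d u) = a \<longleftrightarrow> max c (min d w) = b"
  shows "opposed a b u w"
proof -
  have clamp_low: "max c (min d z) = c \<longleftrightarrow> z \<le> c" if "d = c + 1" for z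
    using that by linarith
  have clamp_high: "max c (min d z) = d \<longleftrightarrow> d \<le> z" if "d = c + 1" for z
    using that by linarith
  show ?thesis
  proof (cases "a < b")
    case True
    hence "a = c" "b = d" "d = c + 1"
      using assms(1-5) by linarith+
    thus ?thesis
      using assms(7) clamp_low[of u] clamp_high[of w] unfolding opposed_def by auto
  next
    case False
    hence "a = d" "b = c" "d = c + 1"
      using assms(1-6) by linarith+
    thus ?thesis
      using assms(7) clamp_high[of u] clamp_low[of w] unfolding opposed_def by auto
  qed
qed

lemma sgn_step_closer: "nat \<bar>b - (a + sgn (b - a))\<bar> = nat \<bar>b - a\<bar> - 1" for a b :: int
  by (auto simp: sgn_if)

lemma box_eqI:
  assumes "x \<in> box I p q" "y \<in> box I p q" "\<And>k. k \<in> I \<Longrightarrow> x k = y k"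
  shows "x = y"
  using assms unfolding box_def by (rule PiE_ext)

lemma box_mono:
  assumes "\<And>k. k \<in> I \<Longrightarrow> p k \<le> p' k" "\<And>k. k \<in> I \<Longrightarrow> q' k \<le> q k"
  shows "box I p' q' \<subseteq> box I p q"
  using assms unfolding box_def by (intro PiE_mono) auto

lemma step_toward_in_box:
  assumes "x \<in> box I p q" "y \<in> box I p q" "i \<in> I"
  shows "step_toward x y i \<in> box I p q"
proof -
  have "p i \<le> x i + sgn (y i - x i) \<and> x i + sgn (y i - x i) \<le> q i"
    using assms unfolding box_def PiE_iff by (cases "x i" "y i" rule: linorder_cases) fastforce+
  thus ?thesis
    using assms unfolding box_def step_toward_def PiE_iff extensional_def by auto
qed

text \<open>Isolates the fixed-point argument from the Boolean coding; \<open>no_effect\<close> is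
  all that remains of acyclicity.\<close>

locale locally_acyclic_map =
  fixes I :: "'a set" and lo hi :: "'a vec" and f :: "'a vec \<Rightarrow> 'a vec"
  assumes finite_index: "finite I"
    and no_effect:
      "\<lbrakk>x \<in> box I lo hi; y \<in> box I lo hi; x \<noteq> y\<rbrakk> \<Longrightarrow>
        \<exists>i\<in>I. x i \<noteq> y i \<and> (\<forall>k\<in>I. x k \<noteq> y k \<longrightarrow>
          (f (step_toward x y i) k \<ge> threshold (x k) (y k) \<longleftrightarrow> f x k \<ge> threshold (x k) (y k)))"
begin

lemma exists_coordinate_not_opposed:
  assumes "x \<in> box I lo hi" "y \<in> box I lo hi" "x \<noteq> y"
  shows "\<exists>k\<in>I. x k \<noteq> y k \<and> \<not> opposed (x k) (y k) (f x k) (f y k)"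
  using assms
proof (induction "\<Sum>k\<in>I. nat \<bar>y k - x k\<bar>" arbitrary: x rule: less_induct)
  case less
  obtain i where i: "i \<in> I" "x i \<noteq> y i"
    and same: "\<And>k. k \<in> I \<Longrightarrow> x k \<noteq> y k \<Longrightarrow>
      f (step_toward x y i) k \<ge> threshold (x k) (y k) \<longleftrightarrow> f x k \<ge> threshold (x k) (y k)"
    using no_effect[OF less.prems] by blast
  let ?x' = "step_toward x y i"
  show ?case
  proof (cases "?x' = y")
    case True
    hence "x i + sgn (y i - x i) = y i"
      by (metis step_toward_def fun_upd_same)
    thus ?thesis
      using not_opposed_adjacent[of "x i" "y i"] same[OF i] i unfolding True by blast
  next
    case False
    have x'_box: "?x' \<in> box I lo hi"
      using step_toward_in_box less.prems(1,2) i(1) .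
    have "(\<Sum>k\<in>I. nat \<bar>y k - ?x' k\<bar>) < (\<Sum>k\<in>I. nat \<bar>y k - x k\<bar>)"
    proof (rule sum_strict_mono_ex1[OF finite_index])
      show "\<forall>k\<in>I. nat \<bar>y k - ?x' k\<bar> \<le> nat \<bar>y k - x k\<bar>"
        by (simp add: step_toward_def sgn_step_closer del: nat_abs_int_diff)
      show "\<exists>k\<in>I. nat \<bar>y k - ?x' k\<bar> < nat \<bar>y k - x k\<bar>"
        using i by (intro bexI[of _ i]) (simp_all add: step_toward_def sgn_step_closer)
    qed
    then obtain k where k: "k \<in> I" "?x' k \<noteq> y k" "\<not> opposed (?x' k) (y k) (f ?x' k) (f y k)"
      using less.hyps[OF _ x'_box less.prems(2) False] by blast
    have step: "?x' k = x k \<or> ?x' k = x k + sgn (y k - x k)"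
      by (simp add: step_toward_def)
    \<comment> \<open>A coordinate that agrees with \<open>y\<close> is left alone by the step,
      since \<open>sgn 0 = 0\<close>.\<close>
    hence "x k \<noteq> y k"
      using k(2) by auto
    thus ?thesis
      using opposed_step[OF _ step k(2) same[OF k(1)]] k by blast
  qed
qed

text \<open>If \<open>x k < y k\<close>, then \<open>x k < q k\<close> and \<open>p k < y k\<close>,
  so truncation forces \<open>f x k \<le> x k\<close> and \<open>y k \<le> f y k\<close>. Two fixed
  points are thus opposed wherever they differ.\<close>

lemma clamped_fixpoint_unique:
  assumes "box I p q \<subseteq> box I lo hi"
    and "clamped_fixpoint I f p q x" "clamped_fixpoint I f p q y"
  shows "x = y"
proof (rule ccontr)
  assume "x \<noteq> y"
  then obtain k where k: "k \<in> I" "x k \<noteq> y k" "\<not> opposed (x k) (y k) (f x k) (f y k)"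
    using exists_coordinate_not_opposed[of x y] assms unfolding clamped_fixpoint_def by blast
  moreover have "max (p k) (min (q k) (f x k)) = x k" "max (p k) (min (q k) (f y k)) = y k"
    using assms k(1) unfolding clamped_fixpoint_def by auto
  moreover have "p k \<le> x k" "x k \<le> q k" "p k \<le> y k" "y k \<le> q k"
    using assms k(1) unfolding clamped_fixpoint_def box_def by auto
  ultimately show False
    unfolding opposed_def by linarith
qed

lemma clamped_fixpoint_exists_unit_box:
  assumes sub: "box I p q \<subseteq> box I lo hi"
    and unit: "\<And>k. k \<in> I \<Longrightarrow> p k \<le> q k \<and> q k \<le> p k + 1"
  shows "\<exists>x. clamped_fixpoint I f p q x"
proof -
  \<comment> \<open>\<open>h x\<close> records the set of moved coordinates as a corner of the box;
    the corner \<open>p\<close> stands for the empty set.\<close>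
  define h where
    "h x = (\<lambda>k\<in>I. if max (p k) (min (q k) (f x k)) = x k then p k else q k)" for x
  have fin: "finite (box I p q)"
    unfolding box_def using finite_index by (intro finite_PiE) auto
  have "h ` box I p q \<subseteq> box I p q"
    using unit by (auto simp: h_def box_def)
  moreover have "inj_on h (box I p q)"
  proof (rule inj_onI, rule ccontr)
    fix x y assume x: "x \<in> box I p q" and y: "y \<in> box I p q" and eq: "h x = h y" and "x \<noteq> y"
    then obtain k where k: "k \<in> I" "x k \<noteq> y k" "\<not> opposed (x k) (y k) (f x k) (f y k)"
      using exists_coordinate_not_opposed[of x y] sub by blast
    have bounds: "p k \<le> x k" "x k \<le> q k" "p k \<le> y k" "y k \<le> q k"
      using x y k(1) unfolding box_def by auto
    have "p k \<noteq> q k"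
      using bounds k(2) by linarith
    hence "max (p k) (min (q k) (f x k)) = x k \<longleftrightarrow> max (p k) (min (q k) (f y k)) = y k"
      using fun_cong[OF eq, of k] k(1) unfolding h_def by (simp split: if_splits)
    hence "opposed (x k) (y k) (f x k) (f y k)"
      using opposed_unit_interval bounds k(2) unit[OF k(1)] by blast
    thus False
      using k(3) by blast
  qed
  ultimately have "h ` box I p q = box I p q"
    using endo_inj_surj[OF fin] by blast
  moreover have "restrict p I \<in> box I p q"
    using unit by (auto simp: box_def)
  ultimately obtain x where x: "x \<in> box I p q" and hx: "h x = restrict p I"
    by (metis imageE)
  \<comment> \<open>Where \<open>p k = q k\<close>, \<open>h\<close> carries no information, but
    truncation then has only one value.\<close>
  have "max (p k) (min (q k) (f x k)) = x k" if k: "k \<in> I" for k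
    using fun_cong[OF hx, of k] k x unfolding h_def box_def by (force split: if_splits)
  thus ?thesis
    using x unfolding clamped_fixpoint_def by blast
qed

lemma clamped_fixpoint_exists:
  assumes "box I p q \<subseteq> box I lo hi" "\<And>k. k \<in> I \<Longrightarrow> p k \<le> q k"
  shows "\<exists>x. clamped_fixpoint I f p q x"
  using assms
proof (induction "\<Sum>k\<in>I. nat (q k - p k)" arbitrary: p q rule: less_induct)
  case less
  show ?case
  proof (cases "\<forall>k\<in>I. q k \<le> p k + 1")
    case True
    thus ?thesis
      using clamped_fixpoint_exists_unit_box less.prems by blast
  next
    case False
    then obtain i where i: "i \<in> I" "p i + 1 < q i" by force
    \<comment> \<open>The two boxes overlap in the layer \<open>q i - 1\<close>. Both are strictly
      smaller because side \<open>i\<close> has length at least two.\<close>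
    define q' where "q' = q(i := q i - 1)"
    define p' where "p' = p(i := q i - 1)"
    have smaller: "(\<Sum>k\<in>I. nat (q' k - p k)) < (\<Sum>k\<in>I. nat (q k - p k))"
      "(\<Sum>k\<in>I. nat (q k - p' k)) < (\<Sum>k\<in>I. nat (q k - p k))"
      using i by (auto intro!: sum_strict_mono_ex1[OF finite_index] bexI[of _ i]
          simp: p'_def q'_def)
    have sub: "box I p q' \<subseteq> box I p q" "box I p' q \<subseteq> box I p q" "box I p' q' \<subseteq> box I p q"
      using i unfolding p'_def q'_def by (intro box_mono; simp)+
    have ordered: "p k \<le> q' k" "p' k \<le> q k" if "k \<in> I" for k
      using less.prems(2)[OF that] i(2) by (auto simp: p'_def q'_def)
    obtain \<xi> where \<xi>: "clamped_fixpoint I f p q' \<xi>"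
      using less.hyps[OF smaller(1)] sub(1) less.prems(1) ordered(1) by blast
    obtain \<zeta> where \<zeta>: "clamped_fixpoint I f p' q \<zeta>"
      using less.hyps[OF smaller(2)] sub(2) less.prems(1) ordered(2) by blast
    have \<xi>D: "\<xi> \<in> box I p q'" "\<And>k. k \<in> I \<Longrightarrow> max (p k) (min (q' k) (f \<xi> k)) = \<xi> k"
      and \<zeta>D: "\<zeta> \<in> box I p' q" "\<And>k. k \<in> I \<Longrightarrow> max (p' k) (min (q k) (f \<zeta> k)) = \<zeta> k"
      using \<xi> \<zeta> unfolding clamped_fixpoint_def by auto
    have \<xi>_bounds: "p k \<le> \<xi> k" "\<xi> k \<le> q' k" and \<zeta>_bounds: "p' k \<le> \<zeta> k" "\<zeta> k \<le> q k"
      if "k \<in> I" for k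
      using \<xi>D(1) \<zeta>D(1) that unfolding box_def by auto
    have lift\<xi>: "clamped_fixpoint I f p q \<xi>" if "max (p i) (min (q i) (f \<xi> i)) = \<xi> i"
      unfolding clamped_fixpoint_def
    proof (intro conjI ballI)
      show "\<xi> \<in> box I p q" using \<xi>D(1) sub(1) by blast
      show "max (p k) (min (q k) (f \<xi> k)) = \<xi> k" if "k \<in> I" for k
        using \<xi>D(2)[OF that] \<open>max (p i) (min (q i) (f \<xi> i)) = \<xi> i\<close>
        by (cases "k = i") (auto simp: q'_def)
    qed
    have lift\<zeta>: "clamped_fixpoint I f p q \<zeta>" if "max (p i) (min (q i) (f \<zeta> i)) = \<zeta> i"
      unfolding clamped_fixpoint_def
    proof (intro conjI ballI)
      show "\<zeta> \<in> box I p q" using \<zeta>D(1) sub(2) by blast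
      show "max (p k) (min (q k) (f \<zeta> k)) = \<zeta> k" if "k \<in> I" for k
        using \<zeta>D(2)[OF that] \<open>max (p i) (min (q i) (f \<zeta> i)) = \<zeta> i\<close>
        by (cases "k = i") (auto simp: p'_def)
    qed
    show ?thesis
    proof (rule ccontr)
      assume "\<not> ?thesis"
      hence no: "max (p i) (min (q i) (f \<xi> i)) \<noteq> \<xi> i" "max (p i) (min (q i) (f \<zeta> i)) \<noteq> \<zeta> i"
        using lift\<xi> lift\<zeta> by blast+
      \<comment> \<open>Only the new bound at \<open>q i - 1\<close> can spoil the lift, so both
        points lie in the common layer.\<close>
      have \<xi>i: "\<xi> i = q i - 1 \<and> q i \<le> f \<xi> i"
        using no(1) \<xi>D(2)[OF i(1)] \<xi>_bounds[OF i(1)] i(2) by (auto simp: q'_def)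
      have \<zeta>i: "\<zeta> i = q i - 1 \<and> f \<zeta> i < q i"
        using no(2) \<zeta>D(2)[OF i(1)] \<zeta>_bounds[OF i(1)] i(2) by (auto simp: p'_def)
      \<comment> \<open>On the layer coordinate \<open>i\<close> is frozen, and the other bounds are
        unchanged.\<close>
      have "max (p' k) (min (q' k) (f \<xi> k)) = \<xi> k \<and> p' k \<le> \<xi> k \<and> \<xi> k \<le> q' k"
        "max (p' k) (min (q' k) (f \<zeta> k)) = \<zeta> k \<and> p' k \<le> \<zeta> k \<and> \<zeta> k \<le> q' k" if "k \<in> I" for k
        using \<xi>D(2)[OF that] \<zeta>D(2)[OF that] \<xi>_bounds[OF that] \<zeta>_bounds[OF that] \<xi>i \<zeta>i
        by (cases "k = i"; force simp: p'_def q'_def)+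
      hence "clamped_fixpoint I f p' q' \<xi>" "clamped_fixpoint I f p' q' \<zeta>"
        using \<xi>D(1) \<zeta>D(1) unfolding clamped_fixpoint_def box_def PiE_iff by auto
      hence "\<xi> = \<zeta>"
        using clamped_fixpoint_unique[of p' q'] sub(3) less.prems(1) by blast
      thus False
        using \<xi>i \<zeta>i by simp
    qed
  qed
qed

theorem unique_fixpoint:
  assumes maps: "f \<in> box I lo hi \<rightarrow> box I lo hi" and "\<And>k. k \<in> I \<Longrightarrow> lo k \<le> hi k"
  shows "\<exists>!x. x \<in> box I lo hi \<and> f x = x"
proof -
  have "clamped_fixpoint I f lo hi x \<longleftrightarrow> x \<in> box I lo hi \<and> f x = x" for x
  proof (cases "x \<in> box I lo hi")
    case True
    hence fx: "f x \<in> box I lo hi" using maps by blast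
    hence "max (lo k) (min (hi k) (f x k)) = f x k" if "k \<in> I" for k
      using PiE_mem[OF fx[unfolded box_def] that] by simp
    thus ?thesis
      using True box_eqI[OF fx True] unfolding clamped_fixpoint_def by auto
  qed (simp add: clamped_fixpoint_def)
  thus ?thesis
    using clamped_fixpoint_exists[of lo hi] clamped_fixpoint_unique[of lo hi] assms(2) by blast
qed

end

section \<open>Acyclicity of the Boolean local graphs\<close>

lemma state_space_eq_box: "state_space n m = box {1..n} (\<lambda>_. 0) (\<lambda>i. int (m i))"
  unfolding state_space_def box_def ..

lemma bool_conj_beta:
  assumes "x \<in> state_space n m"
  shows "bool_conj n m f (beta n m x) = beta n m (f x)"
  using assms by (simp add: bool_conj_def inv_into_f_f[OF inj_on_beta])

text \<open>The unary codes of two consecutive values differ in a single bit, indexed by the larger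
  value.\<close>

lemma add_unit_beta:
  assumes "x i \<ge> 0" "s \<in> {-1, 1}" "j = nat (max (x i) (x i + s))"
  shows "add_unit (bool_index n m) (beta n m x) s (i, j) = beta n m (x(i := x i + s))"
  using assms
  by (auto simp: fun_eq_iff add_unit_def unit_vec_def beta_def bool_index_def max_def)

text \<open>Otherwise every vertex \<open>v i\<close> with \<open>i \<in> D\<close> has an edge to
  some \<open>v k\<close> with \<open>k \<in> D\<close>, and these finitely many vertices carry a
  cycle.\<close>

lemma acyclic_imp_no_effect:
  assumes maps: "f \<in> state_space n m \<rightarrow> state_space n m"
    and x: "x \<in> state_space n m" and y: "y \<in> state_space n m" and "x \<noteq> y"
    and acyclic: "\<not> (\<exists>es. elementary_cycle
      (interaction_graph (bool_index n m) (admissible n m) (bool_conj n m f) (beta n m x)) es)"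
  shows "\<exists>i\<in>{1..n}. x i \<noteq> y i \<and> (\<forall>k\<in>{1..n}. x k \<noteq> y k \<longrightarrow>
    (f (step_toward x y i) k \<ge> threshold (x k) (y k) \<longleftrightarrow> f x k \<ge> threshold (x k) (y k)))"
proof (rule ccontr)
  assume none: "\<not> ?thesis"
  let ?E = "interaction_graph (bool_index n m) (admissible n m) (bool_conj n m f) (beta n m x)"
  define D where "D = {i \<in> {1..n}. x i \<noteq> y i}"
  define v where "v i = (i, nat (threshold (x i) (y i)))" for i
  have "D \<noteq> {}"
    using box_eqI x y \<open>x \<noteq> y\<close> unfolding D_def state_space_eq_box by blast
  have bounds: "0 \<le> x i" "x i \<le> int (m i)" "0 \<le> y i" "y i \<le> int (m i)" if "i \<in> D" for i
    using x y that by (auto simp: D_def state_space_def PiE_iff)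
  have v_index: "v i \<in> bool_index n m" and threshold_pos: "threshold (x i) (y i) \<ge> 1" if "i \<in> D" for i
    using that bounds[OF that] by (auto simp: v_def bool_index_def threshold_def D_def)
  have "\<exists>s. \<exists>w\<in>v ` D. (v i, s, w) \<in> ?E" if i: "i \<in> D" for i
  proof -
    let ?s = "sgn (y i - x i)" and ?x' = "step_toward x y i"
    obtain k where k: "k \<in> D"
      "(f ?x' k \<ge> threshold (x k) (y k)) \<noteq> (f x k \<ge> threshold (x k) (y k))"
      using none i unfolding D_def by blast
    have s: "?s \<in> {-1, 1}"
      using i by (auto simp: D_def sgn_if)
    have "threshold (x i) (y i) = max (x i) (x i + ?s)"
      using i by (auto simp: D_def threshold_def sgn_if)
    hence "v i = (i, nat (max (x i) (x i + ?s)))"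
      by (simp only: v_def)
    hence add: "add_unit (bool_index n m) (beta n m x) ?s (v i) = beta n m ?x'"
      unfolding step_toward_def using add_unit_beta[of x i, OF bounds(1)[OF i] s refl] by (simp only:)
    \<comment> \<open>Moving towards a point of the box stays in the box, so the flipped vector is
      admissible and can witness an edge.\<close>
    have x': "?x' \<in> state_space n m"
      using x y i unfolding D_def state_space_eq_box by (auto intro: step_toward_in_box)
    have "beta n m (f ?x') (v k) \<noteq> beta n m (f x) (v k)"
      using v_index[OF k(1)] threshold_pos[OF k(1)] k(2) by (auto simp: beta_def v_def)
    hence "?s * sgn (beta n m (f ?x') (v k) - beta n m (f x) (v k)) \<noteq> 0"
      using s by (auto simp: sgn_if)
    moreover have "beta n m ?x' \<in> admissible n m"
      using x' unfolding admissible_def by blast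
    ultimately have
      "(v i, ?s * sgn (beta n m (f ?x') (v k) - beta n m (f x) (v k)), v k) \<in> ?E"
      using s v_index[OF i] v_index[OF k(1)] add
      unfolding interaction_graph_def bool_conj_beta[OF x] mem_Collect_eq prod.case
      by (auto simp: bool_conj_beta[OF x'] intro!: bexI[of _ ?s])
    thus ?thesis
      using k(1) by blast
  qed
  moreover have "finite D"
    by (simp add: D_def)
  ultimately show False
    using elementary_cycle_exists[of "v ` D" ?E] \<open>D \<noteq> {}\<close> acyclic by blast
qed

theorem theorem7:
  fixes n :: nat and m :: "nat \<Rightarrow> nat" and f :: "nat vec \<Rightarrow> nat vec"
  assumes "\<And>i. i \<in> {1..n} \<Longrightarrow> m i \<ge> 1"
    and "f \<in> state_space n m \<rightarrow> state_space n m"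
    and "\<And>x. x \<in> admissible n m \<Longrightarrow>
           \<not> (\<exists>es. elementary_cycle
                 (interaction_graph (bool_index n m) (admissible n m) (bool_conj n m f) x) es)"
  shows "\<exists>!x. x \<in> admissible n m \<and> bool_conj n m f x = x"
proof -
  interpret locally_acyclic_map "{1..n}" "\<lambda>_. 0" "\<lambda>i. int (m i)" f
  proof
    show "finite {1..n}" by simp
  next
    fix x y assume "x \<in> box {1..n} (\<lambda>_. 0) (\<lambda>i. int (m i))"
      "y \<in> box {1..n} (\<lambda>_. 0) (\<lambda>i. int (m i))" "x \<noteq> y"
    thus "\<exists>i\<in>{1..n}. x i \<noteq> y i \<and> (\<forall>k\<in>{1..n}. x k \<noteq> y k \<longrightarrow>
      (f (step_toward x y i) k \<ge> threshold (x k) (y k) \<longleftrightarrow> f x k \<ge> threshold (x k) (y k)))"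
      using acyclic_imp_no_effect[OF assms(2)] assms(3)
      unfolding state_space_eq_box[symmetric] admissible_def by blast
  qed
  have ex1: "\<exists>!x. x \<in> state_space n m \<and> f x = x"
    using unique_fixpoint assms(2) unfolding state_space_eq_box by simp
  \<comment> \<open>\<open>beta\<close> is injective on the state space, so it matches the fixed
    points of \<open>f\<close> with those of its Boolean conjugate.\<close>
  have fix_iff: "bool_conj n m f (beta n m x) = beta n m x \<longleftrightarrow> f x = x"
    if "x \<in> state_space n m" for x
    using inj_on_eq_iff[OF inj_on_beta funcset_mem[OF assms(2) that] that] bool_conj_beta[OF that]
    by simp
  show ?thesis
    using ex1 fix_iff unfolding admissible_def by (auto 4 4)
qed

end
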